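(* Let $(B_t)_{t\ge 0}$ be a one-dimensional Brownian motion, and let $f:\mathbb{R}\to\mathbb{R}$ be a Borel measurable function which is polynomially bounded. If the process $f(B_t)-\mathbb{E}[f(B_t)]$, $t\ge 0$, is a martingale, then: (i) there is a twice differentiable function $\tilde f:\mathbb{R}\to\mathbb{R}$ such that $f=\tilde f$ Lebesgue almost everywhere and $A\tilde f$ is constant, where $A=\frac12\frac{d^2}{dx^2}$ is the (weakly extended) generator of Brownian motion; (ii) there are constants $a,b,c\in\mathbb{R}$ such that $f(x)=ax^2+bx+c$ for Lebesgue almost every $x\in\mathbb{R}$.
   Context: Brownian motion starts at $B_0=0$ and is standard (variance $t$ at time $t$). Polynomially bounded means $|f(x)|\le C(1+|x|)^N$ for all $x$, for some constants $C>0$, $N\in\mathbb{N}$. Martingales are with respect to the natural filtration $\mathcal{F}_t=\sigma(B_s: s\le t)$. The weakly extended generator is defined by $\langle Af,\phi\rangle:=\langle f,A^*\phi\rangle$ for all $\phi\in C_c^\infty(\mathbb{R})$, where $A^*$ is the formal adjoint of the generator $A$; for Brownian motion $A=A^*=\frac12\frac{d^2}{dx^2}$. *)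

theory Defs
  imports "HOL-Probability.Probability"
begin

section \<open>Natural filtration and martingales in continuous time\<close>

definition natural_filtration :: "'a measure \<Rightarrow> (real \<Rightarrow> 'a \<Rightarrow> real) \<Rightarrow> real \<Rightarrow> 'a measure" where
  "natural_filtration M X t =
    sigma (space M) {X s -` S \<inter> space M | s S. 0 \<le> s \<and> s \<le> t \<and> S \<in> sets borel}"

text \<open>
  The index set is \<open>t \<ge> 0\<close>. The requirements that \<open>F\<close> be a filtration of sub-\<open>\<sigma>\<close>-algebras
  of \<open>M\<close> hold automatically for natural filtrations; see the two lemmas below.
\<close>

definition martingale ::
  "'a measure \<Rightarrow> (real \<Rightarrow> 'a measure) \<Rightarrow> (real \<Rightarrow> 'a \<Rightarrow> real) \<Rightarrow> bool" where
  "martingale M F X \<longleftrightarrow>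
    filtration (space M) F \<and>
    (\<forall>t\<ge>0. subalgebra M (F t)) \<and>
    (\<forall>t\<ge>0. X t \<in> borel_measurable (F t)) \<and>
    (\<forall>t\<ge>0. integrable M (X t)) \<and>
    (\<forall>s t. 0 \<le> s \<and> s \<le> t \<longrightarrow> (AE \<omega> in M. real_cond_exp M (F s) (X t) \<omega> = X s \<omega>))"

lemma space_natural_filtration [simp]: "space (natural_filtration M X t) = space M"
  unfolding natural_filtration_def by (rule space_measure_of) auto

lemma sets_natural_filtration:
  "sets (natural_filtration M X t) =
    sigma_sets (space M) {X s -` S \<inter> space M | s S. 0 \<le> s \<and> s \<le> t \<and> S \<in> sets borel}"
  unfolding natural_filtration_def by (rule sets_measure_of) auto

lemma filtration_natural_filtration: "filtration (space M) (natural_filtration M X)"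
proof
  fix s t :: real
  assume "s \<le> t"
  then show "sets (natural_filtration M X s) \<subseteq> sets (natural_filtration M X t)"
    unfolding sets_natural_filtration by (intro sigma_sets_mono') (force intro: order_trans)
qed simp

lemma subalgebra_natural_filtration:
  assumes "\<And>s. 0 \<le> s \<Longrightarrow> X s \<in> borel_measurable M"
  shows "subalgebra M (natural_filtration M X t)"
  unfolding subalgebra_def sets_natural_filtration
  by (auto intro!: sets.sigma_sets_subset measurable_sets[OF assms])

section \<open>Standard Brownian motion\<close>

text \<open>
  Only \<open>B t\<close> with \<open>t \<ge> 0\<close> matters. The starting point and path continuity are required almost
  surely, which also covers the convention where they hold for every \<open>\<omega>\<close>.
  The second parameter of \<^const>\<open>normal_density\<close> is the standard deviation.
\<close>

definition brownian_motion :: "'a measure \<Rightarrow> (real \<Rightarrow> 'a \<Rightarrow> real) \<Rightarrow> bool" where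
  "brownian_motion M B \<longleftrightarrow>
    prob_space M \<and>
    (\<forall>t\<ge>0. B t \<in> borel_measurable M) \<and>
    (AE \<omega> in M. B 0 \<omega> = 0) \<and>
    (\<forall>n::nat. \<forall>\<tau>::nat \<Rightarrow> real. 0 \<le> \<tau> 0 \<and> (\<forall>i<n. \<tau> i \<le> \<tau> (Suc i)) \<longrightarrow>
      prob_space.indep_vars M (\<lambda>_. borel) (\<lambda>i \<omega>. B (\<tau> (Suc i)) \<omega> - B (\<tau> i) \<omega>) {..<n}) \<and>
    (\<forall>s t. 0 \<le> s \<and> s < t \<longrightarrow>
      distributed M lborel (\<lambda>\<omega>. B t \<omega> - B s \<omega>) (normal_density 0 (sqrt (t - s)))) \<and>
    (AE \<omega> in M. continuous_on {0..} (\<lambda>t. B t \<omega>))"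

section \<open>Function classes and the generator\<close>

definition polynomially_bounded :: "(real \<Rightarrow> real) \<Rightarrow> bool" where
  "polynomially_bounded f \<longleftrightarrow> (\<exists>C>0. \<exists>N::nat. \<forall>x. \<bar>f x\<bar> \<le> C * (1 + \<bar>x\<bar>) ^ N)"

definition twice_differentiable :: "(real \<Rightarrow> real) \<Rightarrow> bool" where
  "twice_differentiable g \<longleftrightarrow>
    (\<forall>x. g differentiable at x) \<and> (\<forall>x. deriv g differentiable at x)"

definition test_functions :: "(real \<Rightarrow> real) set" where
  "test_functions = {\<phi>. (\<forall>n x. (deriv ^^ n) \<phi> differentiable at x) \<and>
                        compact (closure (support_on UNIV \<phi>))}"

definition bm_generator :: "(real \<Rightarrow> real) \<Rightarrow> real \<Rightarrow> real" where
  "bm_generator \<phi> x = (1 / 2) * deriv (deriv \<phi>) x"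

text \<open>
  A locally integrable function \<open>f\<close> is identified with the functional
  \<open>\<phi> \<mapsto> \<langle>f, \<phi>\<rangle>\<close> on \<^const>\<open>test_functions\<close>. The weakly extended generator sends \<open>f\<close> to the
  functional \<open>\<phi> \<mapsto> \<langle>f, A* \<phi>\<rangle>\<close>; the parameter \<open>A_adj\<close> is the formal adjoint \<open>A*\<close>.
\<close>

definition pairing :: "(real \<Rightarrow> real) \<Rightarrow> (real \<Rightarrow> real) \<Rightarrow> real" where
  "pairing f \<phi> = (\<integral>x. f x * \<phi> x \<partial>lborel)"

definition weakly_extended ::
  "((real \<Rightarrow> real) \<Rightarrow> real \<Rightarrow> real) \<Rightarrow> (real \<Rightarrow> real) \<Rightarrow> (real \<Rightarrow> real) \<Rightarrow> real" where
  "weakly_extended A_adj f \<phi> = pairing f (A_adj \<phi>)"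

text \<open>The generator of Brownian motion is its own formal adjoint.\<close>

definition weak_bm_generator :: "(real \<Rightarrow> real) \<Rightarrow> (real \<Rightarrow> real) \<Rightarrow> real" where
  "weak_bm_generator = weakly_extended bm_generator"

definition constant_functional :: "((real \<Rightarrow> real) \<Rightarrow> real) \<Rightarrow> bool" where
  "constant_functional T \<longleftrightarrow> (\<exists>k::real. \<forall>\<phi>\<in>test_functions. T \<phi> = pairing (\<lambda>_. k) \<phi>)"

end

theory Submission
  imports Defs
begin

text \<open>
  Let \<open>P\<^sub>h f x = E f (x + B\<^sub>h)\<close>. The martingale property says that \<open>P\<^sub>h f = f + c h\<close> almost
  everywhere for a number \<open>c h\<close>, so \<open>f\<close> agrees almost everywhere with the smooth function
  \<open>g = P\<^sub>1 f - c 1\<close>, which satisfies \<open>P\<^sub>h g = g + c h\<close> everywhere. Hence \<open>g' = (P\<^sub>h g)'\<close> for every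
  \<open>h\<close>; putting the derivative on the Gaussian kernel and taking \<open>sqrt h = 1 + \<bar>x\<bar>\<close> shows that \<open>g'\<close>
  grows one degree slower than \<open>g\<close> (letting \<open>h\<close> tend to infinity gives \<open>g' = 0\<close> if \<open>g\<close> is bounded).
  As \<open>P\<^sub>h g' = g'\<close>, induction on the growth degree makes \<open>g'\<close> quadratic, and \<open>P\<^sub>1 g' = g'\<close> forces
  its leading coefficient to vanish, so \<open>g\<close> is quadratic.
\<close>

section \<open>Differentiation under the integral sign\<close>

text \<open>Dominated convergence works along sequences, so the limit is tested on sequences
  \<open>X\<close> tending to \<open>x\<close>. The mean value inequality on the convex ball turns
  the bound on \<open>F'\<close> into the majorant \<open>w\<close> for the difference quotients
  \<open>q\<close>.\<close>

lemma has_real_derivative_integral: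
  fixes F F' :: "real \<Rightarrow> 'b \<Rightarrow> real"
  assumes int: "\<And>u. u \<in> ball x 1 \<Longrightarrow> integrable M (F u)"
    and der: "\<And>u y. u \<in> ball x 1 \<Longrightarrow> y \<in> space M \<Longrightarrow>
      ((\<lambda>u. F u y) has_real_derivative F' u y) (at u)"
    and bnd: "\<And>u y. u \<in> ball x 1 \<Longrightarrow> y \<in> space M \<Longrightarrow> \<bar>F' u y\<bar> \<le> w y"
    and w: "integrable M w"
  shows "((\<lambda>u. \<integral>y. F u y \<partial>M) has_real_derivative (\<integral>y. F' x y \<partial>M)) (at x)"
proof -
  have x: "x \<in> ball x 1" by simp
  have "((\<lambda>u. ((\<integral>y. F u y \<partial>M) - (\<integral>y. F x y \<partial>M)) / (u - x)) \<longlongrightarrow> (\<integral>y. F' x y \<partial>M))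
      (at x within ball x 1)"
    unfolding tendsto_at_iff_sequentially
  proof (intro allI impI)
    fix X :: "nat \<Rightarrow> real"
    assume X: "\<forall>i. X i \<in> ball x 1 - {x}" and lim: "X \<longlonglongrightarrow> x"
    define q where "q n y = (F (X n) y - F x y) / (X n - x)" for n y
    have meas: "q n \<in> borel_measurable M" for n
      unfolding q_def using int[of "X n"] int[OF x] X by auto
    have ptw: "(\<lambda>n. q n y) \<longlonglongrightarrow> F' x y" if "y \<in> space M" for y
    proof -
      have "((\<lambda>u. (F u y - F x y) / (u - x)) \<longlongrightarrow> F' x y) (at x)"
        using der[OF x that] by (simp add: has_field_derivative_iff)
      moreover have "filterlim X (at x) sequentially"
        using lim X by (auto simp: filterlim_at)
      ultimately show ?thesis
        unfolding q_def by (rule filterlim_compose)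
    qed
    have dom: "norm (q n y) \<le> w y" if y: "y \<in> space M" for n y
    proof -
      have "norm (F (X n) y - F x y) \<le> w y * norm (X n - x)"
      proof (rule field_differentiable_bound[of "ball x 1" "\<lambda>u. F u y" "\<lambda>u. F' u y"])
        show "((\<lambda>u. F u y) has_real_derivative F' u y) (at u within ball x 1)"
          if "u \<in> ball x 1" for u
          by (rule has_field_derivative_at_within[OF der[OF that y]])
      qed (use X x y bnd in auto)
      then show ?thesis
        unfolding q_def using X by (auto simp: divide_simps)
    qed
    have "(\<lambda>n. \<integral>y. q n y \<partial>M) \<longlonglongrightarrow> (\<integral>y. F' x y \<partial>M)"
    proof (rule integral_dominated_convergence[where w = w])
      show "(\<lambda>y. F' x y) \<in> borel_measurable M"
        by (rule borel_measurable_LIMSEQ_real[OF ptw meas])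
    qed (use meas w ptw dom in auto)
    moreover have "(\<integral>y. q n y \<partial>M) = ((\<integral>y. F (X n) y \<partial>M) - (\<integral>y. F x y \<partial>M)) / (X n - x)" for n
      unfolding q_def using int[of "X n"] int[OF x] X by simp
    ultimately show
      "((\<lambda>u. ((\<integral>y. F u y \<partial>M) - (\<integral>y. F x y \<partial>M)) / (u - x)) \<circ> X) \<longlonglongrightarrow> (\<integral>y. F' x y \<partial>M)"
      by (simp add: o_def)
  qed
  then show ?thesis
    by (simp add: has_field_derivative_iff at_within_open[OF x open_ball])
qed

section \<open>Gaussian averages of polynomially bounded functions\<close>

abbreviation \<phi> :: "real \<Rightarrow> real" where "\<phi> \<equiv> std_normal_density"

text \<open>Since \<open>1 + \<bar>z\<bar> \<le> \<bar>z - \<mu>\<bar> + (1 +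
  \<bar>\<mu>\<bar>)\<close>, the binomial theorem reduces this to absolute central moments. Means
  other than 0 occur in the majorant for differentiating \<open>heat\<close>.\<close>

lemma integrable_normal_density_poly:
  "integrable lborel (\<lambda>z. normal_density \<mu> 1 z * (1 + \<bar>z\<bar>) ^ k)"
proof (rule Bochner_Integration.integrable_bound)
  show "integrable lborel (\<lambda>z. \<Sum>i\<le>k. of_nat (k choose i) * (1 + \<bar>\<mu>\<bar>) ^ (k - i) *
      (normal_density \<mu> 1 z * \<bar>z - \<mu>\<bar> ^ i))"
    by (intro Bochner_Integration.integrable_sum integrable_mult_right integrable_normal_moment_abs) simp
  show "AE z in lborel. norm (normal_density \<mu> 1 z * (1 + \<bar>z\<bar>) ^ k) \<le>
     norm (\<Sum>i\<le>k. of_nat (k choose i) * (1 + \<bar>\<mu>\<bar>) ^ (k - i) * (normal_density \<mu> 1 z * \<bar>z - \<mu>\<bar> ^ i))"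
  proof (intro AE_I2)
    fix z :: real
    have "(1 + \<bar>z\<bar>) ^ k \<le> (\<bar>z - \<mu>\<bar> + (1 + \<bar>\<mu>\<bar>)) ^ k"
      by (intro power_mono) auto
    also have "\<dots> = (\<Sum>i\<le>k. of_nat (k choose i) * \<bar>z - \<mu>\<bar> ^ i * (1 + \<bar>\<mu>\<bar>) ^ (k - i))"
      by (rule binomial_ring)
    finally have "normal_density \<mu> 1 z * (1 + \<bar>z\<bar>) ^ k \<le> normal_density \<mu> 1 z * \<dots>"
      by (rule mult_left_mono) simp
    then show "norm (normal_density \<mu> 1 z * (1 + \<bar>z\<bar>) ^ k) \<le>
     norm (\<Sum>i\<le>k. of_nat (k choose i) * (1 + \<bar>\<mu>\<bar>) ^ (k - i) * (normal_density \<mu> 1 z * \<bar>z - \<mu>\<bar> ^ i))"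
      by (simp add: sum_distrib_left mult_ac abs_mult sum_nonneg)
  qed
qed measurable

text \<open>The parameter \<open>\<sigma>\<close> is the standard deviation: \<open>heat \<sigma>\<close> is the heat semigroup at time \<open>\<sigma>\<^sup>2\<close>.\<close>

definition heat :: "real \<Rightarrow> (real \<Rightarrow> real) \<Rightarrow> real \<Rightarrow> real" where
  "heat \<sigma> f x = (\<integral>z. \<phi> z * f (x + \<sigma> * z) \<partial>lborel)"

text \<open>The product form survives raising to a power, so growth in \<open>x\<close>,
  \<open>\<sigma>\<close> and \<open>z\<close> separates in every Gaussian estimate.\<close>

lemma one_plus_abs_add_mult_le:
  fixes x \<sigma> z :: real
  shows "1 + \<bar>x + \<sigma> * z\<bar> \<le> (1 + \<bar>x\<bar>) * (1 + \<bar>\<sigma>\<bar>) * (1 + \<bar>z\<bar>)"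
proof -
  have "\<bar>x + \<sigma> * z\<bar> \<le> \<bar>x\<bar> + \<bar>\<sigma>\<bar> * \<bar>z\<bar>"
    by (metis abs_mult abs_triangle_ineq)
  moreover have "0 \<le> \<bar>x\<bar> * \<bar>\<sigma>\<bar>" "0 \<le> \<bar>x\<bar> * \<bar>z\<bar>" "0 \<le> \<bar>x\<bar> * \<bar>\<sigma>\<bar> * \<bar>z\<bar>"
    by simp_all
  ultimately show ?thesis
    unfolding distrib_left distrib_right mult_1_left mult_1_right by linarith
qed

lemma poly_bound_affine:
  fixes f :: "real \<Rightarrow> real"
  assumes "\<And>x. \<bar>f x\<bar> \<le> C * (1 + \<bar>x\<bar>) ^ N"
  shows "\<bar>f (x + \<sigma> * z)\<bar> \<le> C * ((1 + \<bar>x\<bar>) * (1 + \<bar>\<sigma>\<bar>)) ^ N * (1 + \<bar>z\<bar>) ^ N"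
proof -
  have "0 \<le> C" using assms[of 0] by (simp add: order_trans[OF abs_ge_zero])
  have "\<bar>f (x + \<sigma> * z)\<bar> \<le> C * (1 + \<bar>x + \<sigma> * z\<bar>) ^ N" by (rule assms)
  also have "\<dots> \<le> C * ((1 + \<bar>x\<bar>) * (1 + \<bar>\<sigma>\<bar>) * (1 + \<bar>z\<bar>)) ^ N"
    using one_plus_abs_add_mult_le \<open>0 \<le> C\<close> by (intro mult_left_mono power_mono) auto
  finally show ?thesis by (simp add: power_mult_distrib mult_ac)
qed

lemma integrable_normal_density_mult:
  fixes f :: "real \<Rightarrow> real"
  assumes [measurable]: "f \<in> borel_measurable borel"
    and "\<And>z. \<bar>f z\<bar> \<le> K * (1 + \<bar>z\<bar>) ^ N"
  shows "integrable lborel (\<lambda>z. normal_density \<mu> 1 z * f z)"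
proof (rule Bochner_Integration.integrable_bound)
  show "integrable lborel (\<lambda>z. K * (normal_density \<mu> 1 z * (1 + \<bar>z\<bar>) ^ N))"
    by (intro integrable_mult_right integrable_normal_density_poly)
  show "AE z in lborel. norm (normal_density \<mu> 1 z * f z) \<le>
      norm (K * (normal_density \<mu> 1 z * (1 + \<bar>z\<bar>) ^ N))"
  proof (intro AE_I2)
    fix z :: real
    have "normal_density \<mu> 1 z * \<bar>f z\<bar> \<le> normal_density \<mu> 1 z * (K * (1 + \<bar>z\<bar>) ^ N)"
      using assms by (intro mult_left_mono) auto
    then have "norm (normal_density \<mu> 1 z * f z) \<le> K * (normal_density \<mu> 1 z * (1 + \<bar>z\<bar>) ^ N)"
      by (simp add: abs_mult mult_ac)
    also have "\<dots> \<le> norm \<dots>" by simp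
    finally show "norm (normal_density \<mu> 1 z * f z) \<le>
      norm (K * (normal_density \<mu> 1 z * (1 + \<bar>z\<bar>) ^ N))" .
  qed
qed measurable

text \<open>If \<open>f\<close> is not integrable, its integral is 0 by convention and the claim
  reduces to \<open>g\<close> being nonnegative.\<close>

lemma abs_integral_le_integral:
  fixes f g :: "'b \<Rightarrow> real"
  assumes "integrable M g" "\<And>x. \<bar>f x\<bar> \<le> g x"
  shows "\<bar>\<integral>x. f x \<partial>M\<bar> \<le> (\<integral>x. g x \<partial>M)"
proof (cases "integrable M f")
  case True
  then have "(\<integral>x. \<bar>f x\<bar> \<partial>M) \<le> (\<integral>x. g x \<partial>M)"
    using assms by (intro integral_mono) auto
  then show ?thesis
    using integral_abs_bound[of M f] by linarith
next
  case False
  have "0 \<le> g x" for x using assms(2)[of x] by linarith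
  then show ?thesis
    using False by (simp add: not_integrable_integral_eq Bochner_Integration.integral_nonneg)
qed

lemma heat_bound:
  assumes [measurable]: "f \<in> borel_measurable borel"
    and f: "\<And>x. \<bar>f x\<bar> \<le> C * (1 + \<bar>x\<bar>) ^ N"
  obtains C' where "\<And>x. \<bar>heat \<sigma> f x\<bar> \<le> C' * (1 + \<bar>x\<bar>) ^ N"
proof
  fix x
  have "\<bar>heat \<sigma> f x\<bar> \<le> (\<integral>z. C * ((1 + \<bar>x\<bar>) * (1 + \<bar>\<sigma>\<bar>)) ^ N * (\<phi> z * (1 + \<bar>z\<bar>) ^ N) \<partial>lborel)"
    unfolding heat_def
  proof (rule abs_integral_le_integral)
    show "\<bar>\<phi> z * f (x + \<sigma> * z)\<bar> \<le> C * ((1 + \<bar>x\<bar>) * (1 + \<bar>\<sigma>\<bar>)) ^ N * (\<phi> z * (1 + \<bar>z\<bar>) ^ N)" for z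
      using mult_left_mono[OF poly_bound_affine[OF f, of x \<sigma> z], of "\<phi> z"]
      by (simp add: abs_mult mult_ac)
  qed (intro integrable_mult_right integrable_normal_density_poly)
  also have "\<dots> = (C * (1 + \<bar>\<sigma>\<bar>) ^ N * (\<integral>z. \<phi> z * (1 + \<bar>z\<bar>) ^ N \<partial>lborel)) * (1 + \<bar>x\<bar>) ^ N"
    by (simp add: power_mult_distrib)
  finally show "\<bar>heat \<sigma> f x\<bar> \<le> \<dots>" .
qed

lemma heat_measurable [measurable]:
  assumes [measurable]: "f \<in> borel_measurable borel"
  shows "heat \<sigma> f \<in> borel_measurable borel"
  unfolding heat_def by measurable

text \<open>Translating the integration variable by \<open>u\<close> moves the shift from
  \<open>f\<close> to the density, so differentiation in \<open>u\<close> asks nothing of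
  \<open>f\<close> beyond growth and measurability.\<close>

lemma heat_shift:
  "heat \<sigma> f (x + \<sigma> * u) = (\<integral>z. normal_density u 1 z * f (x + \<sigma> * z) \<partial>lborel)"
  using lborel_integral_real_affine[of 1 "\<lambda>z. normal_density u 1 z * f (x + \<sigma> * z)" u]
  by (simp add: heat_def normal_density_def algebra_simps)

text \<open>An integrable majorant, uniform in the mean, for differentiating Gaussian integrals.\<close>

lemma normal_density_shift_le:
  assumes "\<bar>u\<bar> \<le> 1"
  shows "normal_density u 1 z \<le> exp 1 * (normal_density (-1) 1 z + normal_density 1 1 z)"
proof -
  \<comment> \<open>The sign of \<open>z\<close> decides which shifted Gaussian dominates: \<open>-
    (z - u)^2 \<le> 2 * \<bar>z\<bar> - z^2 = 1 - (\<bar>z\<bar> - 1)^2\<close>. Rounding this 1 up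
    to 2 gives the constant \<open>exp 1\<close>.\<close>
  have "- (z - u)\<^sup>2 / 2 \<le> 1 - (z + 1)\<^sup>2 / 2 \<or> - (z - u)\<^sup>2 / 2 \<le> 1 - (z - 1)\<^sup>2 / 2"
  proof (cases "z \<ge> 0")
    case True
    then have "z * u \<le> z" using assms mult_left_mono[of u 1 z] by simp
    then have "- (z - u)\<^sup>2 \<le> 2 - (z - 1)\<^sup>2"
      using zero_le_power2[of u] unfolding power2_sum power2_diff power_one mult_1_right by linarith
    then show ?thesis by simp
  next
    case False
    then have "z * u \<le> - z" using assms mult_left_mono_neg[of "-1" u z] by simp
    then have "- (z - u)\<^sup>2 \<le> 2 - (z + 1)\<^sup>2"
      using zero_le_power2[of u] unfolding power2_sum power2_diff power_one mult_1_right by linarith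
    then show ?thesis by simp
  qed
  then have "exp (- (z - u)\<^sup>2 / 2) \<le> exp (1 - (z + 1)\<^sup>2 / 2) + exp (1 - (z - 1)\<^sup>2 / 2)"
    by (elim disjE) (auto intro: add_increasing add_increasing2)
  then have "exp (- (z - u)\<^sup>2 / 2) / sqrt (2 * pi) \<le>
      (exp 1 * exp (- (z + 1)\<^sup>2 / 2) + exp 1 * exp (- (z - 1)\<^sup>2 / 2)) / sqrt (2 * pi)"
    by (intro divide_right_mono) (simp_all add: exp_add[symmetric])
  then show ?thesis
    by (simp add: normal_density_def field_simps)
qed

text \<open>Differentiate \<open>heat_shift\<close> at \<open>u = 0\<close>, where the factor
  \<open>z - u\<close> from the density becomes \<open>z\<close>, then substitute
  \<open>u = (y - x) / \<sigma>\<close>, which yields the factor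
  \<open>1 / \<sigma>\<close>.\<close>

lemma heat_has_derivative:
  assumes [measurable]: "f \<in> borel_measurable borel"
    and f: "\<And>x. \<bar>f x\<bar> \<le> C * (1 + \<bar>x\<bar>) ^ N" and \<sigma>: "\<sigma> > 0"
  shows "(heat \<sigma> f has_real_derivative (\<integral>z. \<phi> z * z * f (x + \<sigma> * z) \<partial>lborel) / \<sigma>) (at x)"
proof -
  define K where "K = C * ((1 + \<bar>x\<bar>) * (1 + \<bar>\<sigma>\<bar>)) ^ N"
  have K: "\<bar>f (x + \<sigma> * z)\<bar> \<le> K * (1 + \<bar>z\<bar>) ^ N" for z
    unfolding K_def by (rule poly_bound_affine[OF f])
  have K0: "0 \<le> K" using K[of 0] by (simp add: order_trans[OF abs_ge_zero])
  \<comment> \<open>Three bounds multiplied: the one on the shifted density,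
    \<open>\<bar>z - u\<bar> \<le> 2 * (1 + \<bar>z\<bar>)\<close>, and the growth of
    \<open>f\<close>.\<close>
  define w where "w z = exp 1 * (normal_density (-1) 1 z + normal_density 1 1 z) *
    (2 * (1 + \<bar>z\<bar>) * (K * (1 + \<bar>z\<bar>) ^ N))" for z
  have w: "w z = exp 1 * 2 * K * (normal_density (-1) 1 z * (1 + \<bar>z\<bar>) ^ (Suc N) +
      normal_density 1 1 z * (1 + \<bar>z\<bar>) ^ (Suc N))" for z
    unfolding w_def power_Suc by (simp only: distrib_left distrib_right mult_ac)
  have "((\<lambda>u. \<integral>z. normal_density u 1 z * f (x + \<sigma> * z) \<partial>lborel) has_real_derivative
      (\<integral>z. normal_density 0 1 z * (z - 0) * f (x + \<sigma> * z) \<partial>lborel)) (at 0)"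
  proof (rule has_real_derivative_integral[where w = w and x = 0 and
        F' = "\<lambda>u z. normal_density u 1 z * (z - u) * f (x + \<sigma> * z)"])
    show "integrable lborel (\<lambda>z. normal_density u 1 z * f (x + \<sigma> * z))" for u
      by (rule integrable_normal_density_mult[OF _ K]) measurable
    show "integrable lborel w"
      unfolding w
      by (intro integrable_mult_right Bochner_Integration.integrable_add integrable_normal_density_poly)
    show "((\<lambda>u. normal_density u 1 z * f (x + \<sigma> * z)) has_real_derivative
        normal_density u 1 z * (z - u) * f (x + \<sigma> * z)) (at u)" for u z
    proof (rule DERIV_cmult_right)
      have "((\<lambda>u. - (z - u)\<^sup>2 / 2) has_real_derivative z - u) (at u)"
        by (auto intro!: derivative_eq_intros simp: field_simps)
      then have "((\<lambda>u. 1 / sqrt (2 * pi) * exp (- (z - u)\<^sup>2 / 2)) has_real_derivative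
          1 / sqrt (2 * pi) * (exp (- (z - u)\<^sup>2 / 2) * (z - u))) (at u)"
        by (intro DERIV_cmult DERIV_fun_exp)
      then show "((\<lambda>u. normal_density u 1 z) has_real_derivative normal_density u 1 z * (z - u)) (at u)"
        by (simp add: normal_density_def)
    qed
    fix u z :: real assume "u \<in> ball 0 1"
    then have u: "\<bar>u\<bar> \<le> 1" by simp
    have "\<bar>z - u\<bar> \<le> 2 * (1 + \<bar>z\<bar>)" using u by simp
    then have "\<bar>z - u\<bar> * \<bar>f (x + \<sigma> * z)\<bar> \<le> 2 * (1 + \<bar>z\<bar>) * (K * (1 + \<bar>z\<bar>) ^ N)"
      using K K0 by (intro mult_mono) auto
    with normal_density_shift_le[OF u]
    have "normal_density u 1 z * (\<bar>z - u\<bar> * \<bar>f (x + \<sigma> * z)\<bar>) \<le>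
        (exp 1 * (normal_density (-1) 1 z + normal_density 1 1 z)) *
        (2 * (1 + \<bar>z\<bar>) * (K * (1 + \<bar>z\<bar>) ^ N))"
      by (rule mult_mono) auto
    moreover have "\<bar>normal_density u 1 z * (z - u) * f (x + \<sigma> * z)\<bar> =
        normal_density u 1 z * (\<bar>z - u\<bar> * \<bar>f (x + \<sigma> * z)\<bar>)"
      by (simp add: abs_mult)
    ultimately show "\<bar>normal_density u 1 z * (z - u) * f (x + \<sigma> * z)\<bar> \<le> w z"
      by (simp only: w_def)
  qed
  then have "((\<lambda>u. heat \<sigma> f (x + \<sigma> * u)) has_real_derivative
      (\<integral>z. \<phi> z * z * f (x + \<sigma> * z) \<partial>lborel)) (at 0)"
    by (simp add: heat_shift)
  moreover have "((\<lambda>y. (y - x) / \<sigma>) has_real_derivative 1 / \<sigma>) (at x)"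
    using \<sigma> by (auto intro!: derivative_eq_intros)
  ultimately have "((\<lambda>y. heat \<sigma> f (x + \<sigma> * ((y - x) / \<sigma>))) has_real_derivative
      (\<integral>z. \<phi> z * z * f (x + \<sigma> * z) \<partial>lborel) * (1 / \<sigma>)) (at x)"
    by (intro DERIV_chain2[where g = "\<lambda>y. (y - x) / \<sigma>"]) simp_all
  then show ?thesis using \<sigma> by simp
qed

text \<open>Here the derivative falls on \<open>g\<close> instead of the kernel. Comparing the two
  forms shows that \<open>g'\<close> inherits invariance under \<open>heat\<close>.\<close>

lemma heat_has_derivative_heat:
  assumes [measurable]: "g \<in> borel_measurable borel" "g' \<in> borel_measurable borel"
    and g: "\<And>x. \<bar>g x\<bar> \<le> C * (1 + \<bar>x\<bar>) ^ N"
    and g': "\<And>x. \<bar>g' x\<bar> \<le> C' * (1 + \<bar>x\<bar>) ^ N'"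
    and der: "\<And>x. (g has_real_derivative g' x) (at x)"
  shows "(heat \<sigma> g has_real_derivative heat \<sigma> g' x) (at x)"
proof -
  have C': "0 \<le> C'" using g'[of 0] by (simp add: order_trans[OF abs_ge_zero])
  \<comment> \<open>The \<open>2 + \<bar>x\<bar>\<close> bounds \<open>1 + \<bar>u\<bar>\<close>
    uniformly for \<open>u\<close> in the unit ball around \<open>x\<close>.\<close>
  define w where "w z = C' * ((2 + \<bar>x\<bar>) * (1 + \<bar>\<sigma>\<bar>)) ^ N' * (\<phi> z * (1 + \<bar>z\<bar>) ^ N')" for z
  show ?thesis
    unfolding heat_def
  proof (rule has_real_derivative_integral[where w = w and
        F' = "\<lambda>u z. \<phi> z * g' (u + \<sigma> * z)"])
    show "integrable lborel (\<lambda>z. \<phi> z * g (u + \<sigma> * z))" for u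
      by (rule integrable_normal_density_mult[OF _ poly_bound_affine[OF g]]) measurable
    show "integrable lborel w"
      unfolding w_def by (intro integrable_mult_right integrable_normal_density_poly)
    show "((\<lambda>u. \<phi> z * g (u + \<sigma> * z)) has_real_derivative \<phi> z * g' (u + \<sigma> * z)) (at u)" for u z
      by (rule DERIV_cmult) (use der[of "u + \<sigma> * z"] in \<open>simp add: DERIV_shift\<close>)
    fix u z :: real assume "u \<in> ball x 1"
    then have u: "1 + \<bar>u\<bar> \<le> 2 + \<bar>x\<bar>" by (simp add: dist_real_def)
    have "\<bar>g' (u + \<sigma> * z)\<bar> \<le> C' * ((1 + \<bar>u\<bar>) * (1 + \<bar>\<sigma>\<bar>)) ^ N' * (1 + \<bar>z\<bar>) ^ N'"
      by (rule poly_bound_affine[OF g'])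
    also have "\<dots> \<le> C' * ((2 + \<bar>x\<bar>) * (1 + \<bar>\<sigma>\<bar>)) ^ N' * (1 + \<bar>z\<bar>) ^ N'"
      using u C' by (intro mult_right_mono mult_left_mono power_mono) auto
    finally have "\<phi> z * \<bar>g' (u + \<sigma> * z)\<bar> \<le> \<phi> z * \<dots>"
      by (rule mult_left_mono) simp
    then show "\<bar>\<phi> z * g' (u + \<sigma> * z)\<bar> \<le> w z"
      unfolding w_def by (simp add: abs_mult mult_ac)
  qed
qed

section \<open>Functions that the heat semigroup changes only by constants\<close>

text \<open>The standard normal moments of orders 0, 1, 2 are 1, 0, 1. The value at 0 alone suffices
  to exclude a quadratic term in an invariant function.\<close>

lemma heat_quadratic:
  "heat 1 (\<lambda>x. a * x\<^sup>2 + b * x + c) 0 = a + c"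
proof -
  have "has_bochner_integral lborel (\<lambda>z. a * (\<phi> z * z ^ (2 * 1)) + b * (\<phi> z * z ^ (2 * 0 + 1)) +
     c * (\<phi> z * z ^ (2 * 0))) (a * (fact (2 * 1) / (2 ^ 1 * fact 1)) + b * 0 + c * (fact (2 * 0) / (2 ^ 0 * fact 0)))"
    by (intro has_bochner_integral_add has_bochner_integral_mult_right
        std_normal_moment_even std_normal_moment_odd)
  moreover have "\<phi> z * (a * (0 + 1 * z)\<^sup>2 + b * (0 + 1 * z) + c) =
      a * (\<phi> z * z ^ (2 * 1)) + b * (\<phi> z * z ^ (2 * 0 + 1)) + c * (\<phi> z * z ^ (2 * 0))" for z
    by (simp add: algebra_simps power2_eq_square)
  ultimately show ?thesis
    unfolding heat_def by (simp only: has_bochner_integral_integral_eq) simp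
qed

text \<open>Once \<open>\<sigma>\<close> is at least \<open>1 + \<bar>x\<bar>\<close>, it absorbs
  \<open>x\<close>: \<open>1 + \<bar>x + \<sigma> * z\<bar> \<le> \<sigma> * (1 +
  \<bar>z\<bar>)\<close>. The derivative of \<open>heat \<sigma> f\<close> carries a further
  \<open>1 / \<sigma>\<close>, which saves one power.\<close>

lemma heat_derivative_bound:
  fixes x \<sigma> C :: real
  assumes f: "\<And>x. \<bar>f x\<bar> \<le> C * (1 + \<bar>x\<bar>) ^ N" and \<sigma>: "1 + \<bar>x\<bar> \<le> \<sigma>"
  shows "\<bar>\<integral>z. \<phi> z * z * f (x + \<sigma> * z) \<partial>lborel\<bar> \<le>
    \<sigma> ^ N * (C * (\<integral>z. \<phi> z * (1 + \<bar>z\<bar>) ^ Suc N \<partial>lborel))"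
proof -
  have C: "0 \<le> C" using f[of 0] by (simp add: order_trans[OF abs_ge_zero])
  have "\<bar>\<integral>z. \<phi> z * z * f (x + \<sigma> * z) \<partial>lborel\<bar> \<le>
      (\<integral>z. \<sigma> ^ N * (C * (\<phi> z * (1 + \<bar>z\<bar>) ^ Suc N)) \<partial>lborel)"
  proof (rule abs_integral_le_integral)
    show "integrable lborel (\<lambda>z. \<sigma> ^ N * (C * (\<phi> z * (1 + \<bar>z\<bar>) ^ Suc N)))"
      by (intro integrable_mult_right integrable_normal_density_poly)
    fix z :: real
    have "\<bar>x + \<sigma> * z\<bar> \<le> \<bar>x\<bar> + \<sigma> * \<bar>z\<bar>"
      using abs_triangle_ineq[of x "\<sigma> * z"] \<sigma> by (simp add: abs_mult)
    then have *: "1 + \<bar>x + \<sigma> * z\<bar> \<le> \<sigma> * (1 + \<bar>z\<bar>)"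
      using \<sigma> by (simp add: algebra_simps)
    have "\<bar>f (x + \<sigma> * z)\<bar> \<le> C * (1 + \<bar>x + \<sigma> * z\<bar>) ^ N" by (rule f)
    also have "\<dots> \<le> C * (\<sigma> * (1 + \<bar>z\<bar>)) ^ N"
      using * C by (intro mult_left_mono power_mono) auto
    finally have "\<bar>z\<bar> * \<bar>f (x + \<sigma> * z)\<bar> \<le> (1 + \<bar>z\<bar>) * \<dots>"
      by (intro mult_mono) auto
    then have "\<phi> z * (\<bar>z\<bar> * \<bar>f (x + \<sigma> * z)\<bar>) \<le> \<phi> z * \<dots>"
      by (rule mult_left_mono) simp
    then show "\<bar>\<phi> z * z * f (x + \<sigma> * z)\<bar> \<le> \<sigma> ^ N * (C * (\<phi> z * (1 + \<bar>z\<bar>) ^ Suc N))"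
      by (simp add: abs_mult power_mult_distrib mult_ac)
  qed
  then show ?thesis by simp
qed

text \<open>The constant \<open>c \<sigma>\<close> disappears on differentiation, so one and the
  same derivative is expressed at every scale \<open>\<sigma>\<close>.\<close>

lemma derivative_of_heat_eq_add_const:
  assumes "g \<in> borel_measurable borel"
    and "\<And>x. \<bar>g x\<bar> \<le> C * (1 + \<bar>x\<bar>) ^ N"
    and "\<And>\<sigma> x. \<sigma> > 0 \<Longrightarrow> heat \<sigma> g x = g x + c \<sigma>"
    and "\<sigma> > 0"
  shows "(g has_real_derivative (\<integral>z. \<phi> z * z * g (x + \<sigma> * z) \<partial>lborel) / \<sigma>) (at x)"
proof -
  have "g = (\<lambda>x. heat \<sigma> g x - c \<sigma>)" using assms(3,4) by auto
  moreover have "((\<lambda>x. heat \<sigma> g x - c \<sigma>) has_real_derivative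
      (\<integral>z. \<phi> z * z * g (x + \<sigma> * z) \<partial>lborel) / \<sigma>) (at x)"
    using DERIV_diff[OF heat_has_derivative[OF assms(1,2,4)] DERIV_const] by simp
  ultimately show ?thesis by simp
qed

text \<open>Induction on \<open>N\<close>, with \<open>c\<close> an arbitrary function of
  \<open>\<sigma>\<close>: the induction hypothesis is applied to \<open>g'\<close> with
  \<open>c\<close> equal to 0.\<close>

lemma quadratic_of_heat_eq_add_const:
  assumes "g \<in> borel_measurable borel"
    and "\<And>x. \<bar>g x\<bar> \<le> C * (1 + \<bar>x\<bar>) ^ N"
    and "\<And>\<sigma> x. \<sigma> > 0 \<Longrightarrow> heat \<sigma> g x = g x + c \<sigma>"
  shows "\<exists>a b d. \<forall>x. g x = a * x\<^sup>2 + b * x + d"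
  using assms
proof (induction N arbitrary: g C c)
  case (0 g C c)
  have der: "(g has_real_derivative (\<integral>z. \<phi> z * z * g (x + \<sigma> * z) \<partial>lborel) / \<sigma>) (at x)"
    if "\<sigma> > 0" for \<sigma> x
    by (rule derivative_of_heat_eq_add_const[OF 0 that])
  define K where "K = C * (\<integral>z. \<phi> z * (1 + \<bar>z\<bar>) ^ Suc 0 \<partial>lborel)"
  have "(g has_real_derivative 0) (at x)" for x
  proof -
    \<comment> \<open>The factors \<open>1 *\<close> and \<open>/ 1\<close> make this literally the
      formula at scale 1.\<close>
    define D where "D = (\<integral>z. \<phi> z * z * g (x + 1 * z) \<partial>lborel) / 1"
    have D: "(g has_real_derivative D) (at x)"
      unfolding D_def by (rule der) simp
    \<comment> \<open>By uniqueness of derivatives \<open>D\<close> is also given by the formula at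
      every large \<open>\<sigma>\<close>, which decays like \<open>1 / \<sigma>\<close>.\<close>
    have "\<bar>D\<bar> \<le> K / \<sigma>" if "\<sigma> \<ge> 1 + \<bar>x\<bar>" for \<sigma>
    proof -
      have "\<sigma> > 0" using that by simp
      then have "D = (\<integral>z. \<phi> z * z * g (x + \<sigma> * z) \<partial>lborel) / \<sigma>"
        by (intro DERIV_unique[OF D der])
      moreover have "\<bar>\<integral>z. \<phi> z * z * g (x + \<sigma> * z) \<partial>lborel\<bar> \<le> K"
        using heat_derivative_bound[OF 0(2) that] by (simp add: K_def)
      ultimately show ?thesis
        using \<open>\<sigma> > 0\<close> by (simp add: divide_right_mono)
    qed
    then have "\<forall>\<^sub>F \<sigma> in at_top. \<bar>D\<bar> \<le> K / \<sigma>"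
      unfolding eventually_at_top_linorder by blast
    moreover have "((\<lambda>\<sigma>. K / \<sigma>) \<longlongrightarrow> 0) at_top"
      by (intro tendsto_divide_0[OF tendsto_const] filterlim_at_top_imp_at_infinity filterlim_ident)
    ultimately have "\<bar>D\<bar> \<le> 0"
      by (intro tendsto_lowerbound[of _ 0 at_top "\<bar>D\<bar>"]) auto
    then show ?thesis using D by simp
  qed
  then have "g x = g 0" for x
    by (intro DERIV_isconst_all allI)
  then have "\<forall>x. g x = 0 * x\<^sup>2 + 0 * x + g 0" by simp
  then show ?case by blast
next
  case (Suc N g C c)
  note [measurable] = Suc.prems(1)
  define g' where "g' x = (\<integral>z. \<phi> z * z * g (x + 1 * z) \<partial>lborel) / 1" for x
  have [measurable]: "g' \<in> borel_measurable borel"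
    unfolding g'_def by measurable
  have der_\<sigma>: "(g has_real_derivative (\<integral>z. \<phi> z * z * g (x + \<sigma> * z) \<partial>lborel) / \<sigma>) (at x)"
    if "\<sigma> > 0" for \<sigma> x
    by (rule derivative_of_heat_eq_add_const[OF Suc.prems that])
  have der: "(g has_real_derivative g' x) (at x)" for x
    unfolding g'_def by (rule der_\<sigma>) simp
  have bnd: "\<bar>g' x\<bar> \<le> C * (\<integral>z. \<phi> z * (1 + \<bar>z\<bar>) ^ Suc (Suc N) \<partial>lborel) * (1 + \<bar>x\<bar>) ^ N" for x
  proof -
    \<comment> \<open>The smallest scale that \<open>heat_derivative_bound\<close> allows; dividing
      \<open>\<sigma> ^ Suc N\<close> by \<open>\<sigma>\<close> leaves
      \<open>(1 + \<bar>x\<bar>) ^ N\<close>.\<close>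
    define \<sigma> where "\<sigma> = 1 + \<bar>x\<bar>"
    have "\<sigma> > 0" by (simp add: \<sigma>_def)
    have "g' x = (\<integral>z. \<phi> z * z * g (x + \<sigma> * z) \<partial>lborel) / \<sigma>"
      by (rule DERIV_unique[OF der der_\<sigma>[OF \<open>\<sigma> > 0\<close>]])
    moreover have "\<bar>\<integral>z. \<phi> z * z * g (x + \<sigma> * z) \<partial>lborel\<bar> \<le>
        \<sigma> ^ Suc N * (C * (\<integral>z. \<phi> z * (1 + \<bar>z\<bar>) ^ Suc (Suc N) \<partial>lborel))"
      by (rule heat_derivative_bound[OF Suc.prems(2)]) (simp add: \<sigma>_def)
    ultimately have "\<bar>g' x\<bar> \<le> \<sigma> ^ Suc N * (C * (\<integral>z. \<phi> z * (1 + \<bar>z\<bar>) ^ Suc (Suc N) \<partial>lborel)) / \<sigma>"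
      using \<open>\<sigma> > 0\<close> by (simp add: divide_right_mono del: power_Suc)
    also have "\<dots> = C * (\<integral>z. \<phi> z * (1 + \<bar>z\<bar>) ^ Suc (Suc N) \<partial>lborel) * (1 + \<bar>x\<bar>) ^ N"
      using \<open>\<sigma> > 0\<close> by (simp add: \<sigma>_def[symmetric])
    finally show ?thesis .
  qed
  \<comment> \<open>\<open>heat \<sigma> g\<close> is differentiated in two ways: under the
    integral, and as \<open>g\<close> plus a constant.\<close>
  have heat_g': "heat \<sigma> g' x = g' x" if "\<sigma> > 0" for \<sigma> x
  proof (rule DERIV_unique)
    show "(heat \<sigma> g has_real_derivative heat \<sigma> g' x) (at x)"
      by (rule heat_has_derivative_heat[OF _ _ Suc.prems(2) bnd der]) measurable
    have "heat \<sigma> g = (\<lambda>x. g x + c \<sigma>)" using Suc.prems(3)[OF that] by auto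
    then show "(heat \<sigma> g has_real_derivative g' x) (at x)"
      using DERIV_add[OF der DERIV_const[of "c \<sigma>"]] by simp
  qed
  then obtain a b d where abd: "\<And>x. g' x = a * x\<^sup>2 + b * x + d"
    using Suc.IH[of g' _ "\<lambda>_. 0", OF _ bnd] by auto
  then have "g' = (\<lambda>x. a * x\<^sup>2 + b * x + d)" by auto
  \<comment> \<open>Invariance at the point 0 reads \<open>a + d = d\<close>.\<close>
  then have "a = 0"
    using heat_g'[of 1 0] heat_quadratic[of a b d] by simp
  \<comment> \<open>With \<open>a = 0\<close> the function \<open>g'\<close> is affine, so
    integrating it does not lead beyond degree 2.\<close>
  have "((\<lambda>x. g x - (b / 2 * x\<^sup>2 + d * x)) has_real_derivative 0) (at x)" for x
    using der[of x] unfolding abd by (auto intro!: derivative_eq_intros simp: \<open>a = 0\<close>)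
  then have "g x = b / 2 * x\<^sup>2 + d * x + g 0" for x
    using DERIV_isconst_all[of "\<lambda>x. g x - (b / 2 * x\<^sup>2 + d * x)" x 0] by simp
  then show ?case by blast
qed

section \<open>From almost everywhere to pointwise identities\<close>

text \<open>The set of agreement is closed and has full Lebesgue measure, hence is the whole
  line.\<close>

lemma AE_lborel_eq_imp_eq:
  fixes f g :: "real \<Rightarrow> real"
  assumes "continuous_on UNIV f" "continuous_on UNIV g" "AE x in lborel. f x = g x"
  shows "f x = g x"
proof -
  have "closed {x. f x = g x}"
    using assms(1,2) by (rule closed_Collect_eq)
  moreover have "AE x in lebesgue. x \<in> {x. f x = g x}"
    using AE_completion[OF assms(3)] by simp
  ultimately show ?thesis
    using mem_closed_if_AE_lebesgue by blast
qed

lemma heat_cong_AE: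
  assumes [measurable]: "f \<in> borel_measurable borel" "g \<in> borel_measurable borel"
    and ae: "AE x in lborel. f x = g x" and \<sigma>: "\<sigma> \<noteq> 0"
  shows "heat \<sigma> f x = heat \<sigma> g x"
proof -
  have "AE z in lborel. f (x + \<sigma> * z) = g (x + \<sigma> * z)"
    by (rule AE_borel_affine[OF \<sigma> _ ae]) measurable
  then show ?thesis
    unfolding heat_def by (intro integral_cong_AE) (measurable, auto)
qed

text \<open>Substitute \<open>y = \<sigma> * z\<close>; the Jacobian cancels the
  \<open>1 / \<sigma>\<close> in the density. This form matches the law of a Brownian increment with
  standard deviation \<open>\<sigma>\<close>.\<close>

lemma heat_eq_integral_normal_density:
  assumes \<sigma>: "\<sigma> > 0"
  shows "heat \<sigma> f x = (\<integral>y. normal_density 0 \<sigma> y * f (x + y) \<partial>lborel)"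
proof -
  have "normal_density 0 \<sigma> (\<sigma> * z) = \<phi> z / \<sigma>" for z
    using \<sigma> by (simp add: normal_density_def real_sqrt_mult power_mult_distrib)
  then show ?thesis
    using lborel_integral_real_affine[of \<sigma> "\<lambda>y. normal_density 0 \<sigma> y * f (x + y)" 0] \<sigma>
    by (simp add: heat_def)
qed

text \<open>\<open>heat\<close> ignores null sets, so
  \<open>heat \<sigma> g = heat \<sigma> f\<close>. Both sides of the identity for \<open>g\<close>
  are continuous, which upgrades it from almost every point to every point.\<close>

lemma quadratic_AE_of_heat_AE_eq_add_const:
  assumes [measurable]: "f \<in> borel_measurable borel"
    and f: "\<And>x. \<bar>f x\<bar> \<le> C * (1 + \<bar>x\<bar>) ^ N"
    and ae: "\<And>\<sigma>. \<sigma> > 0 \<Longrightarrow> AE x in lborel. heat \<sigma> f x = f x + c \<sigma>"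
  shows "\<exists>a b d. AE x in lborel. f x = a * x\<^sup>2 + b * x + d"
proof -
  define g where "g x = heat 1 f x - c 1" for x
  have [measurable]: "g \<in> borel_measurable borel"
    unfolding g_def by measurable
  have fg: "AE x in lborel. f x = g x"
    using ae[of 1] by (auto simp: g_def)
  have cont: "continuous_on UNIV (heat \<sigma> f)" if "\<sigma> > 0" for \<sigma>
    using heat_has_derivative[OF assms(1) f that]
    by (intro continuous_at_imp_continuous_on) (blast intro: DERIV_isCont)
  have heat_g: "heat \<sigma> g x = g x + c \<sigma>" if "\<sigma> > 0" for \<sigma> x
  proof -
    have eq: "heat \<sigma> g = heat \<sigma> f"
      using heat_cong_AE[OF _ _ fg] that by auto
    show ?thesis
      unfolding eq
    proof (rule AE_lborel_eq_imp_eq[where f = "heat \<sigma> f" and g = "\<lambda>x. g x + c \<sigma>"])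
      show "continuous_on UNIV (\<lambda>x. g x + c \<sigma>)"
        unfolding g_def using cont[of 1] by (auto intro!: continuous_intros)
      show "AE x in lborel. heat \<sigma> f x = g x + c \<sigma>"
        using ae[OF that] fg by auto
    qed (rule cont[OF that])
  qed
  obtain C' where C': "\<And>x. \<bar>heat 1 f x\<bar> \<le> C' * (1 + \<bar>x\<bar>) ^ N"
    using heat_bound[OF assms(1) f] by blast
  have bnd: "\<bar>g x\<bar> \<le> (C' + \<bar>c 1\<bar>) * (1 + \<bar>x\<bar>) ^ N" for x
  proof -
    have "\<bar>c 1\<bar> * 1 \<le> \<bar>c 1\<bar> * (1 + \<bar>x\<bar>) ^ N"
      by (intro mult_left_mono one_le_power) auto
    then show ?thesis
      using C'[of x] abs_triangle_ineq4[of "heat 1 f x" "c 1"]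
      unfolding g_def distrib_right by linarith
  qed
  then obtain a b d where "\<And>x. g x = a * x\<^sup>2 + b * x + d"
    using quadratic_of_heat_eq_add_const[OF _ bnd heat_g] by auto
  then show ?thesis using fg by auto
qed

section \<open>The weak generator on quadratic polynomials\<close>

text \<open>Two integrations by parts done at once: for the polynomial \<open>p\<close>, the
  function \<open>F = p * \<psi>' - p' * \<psi>\<close> has derivative
  \<open>p * \<psi>'' - p'' * \<psi>\<close> and vanishes outside a compact set.\<close>

lemma integral_mult_deriv_deriv_test_function:
  assumes \<psi>: "\<psi> \<in> test_functions"
  shows "(\<integral>x. (a * x\<^sup>2 + b * x + c) * deriv (deriv \<psi>) x \<partial>lborel) = 2 * a * (\<integral>x. \<psi> x \<partial>lborel)"
proof -
  have diff: "(deriv ^^ n) \<psi> differentiable at x" for n x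
    using \<psi> by (auto simp: test_functions_def)
  have D: "((deriv ^^ n) \<psi> has_real_derivative (deriv ^^ Suc n) \<psi> x) (at x)" for n x
    using diff[of n x] by (simp add: DERIV_deriv_iff_real_differentiable)
  have D0: "(\<psi> has_real_derivative deriv \<psi> x) (at x)"
    and D1: "(deriv \<psi> has_real_derivative deriv (deriv \<psi>) x) (at x)"
    and D2: "(deriv (deriv \<psi>) has_real_derivative deriv (deriv (deriv \<psi>)) x) (at x)" for x
    using D[of 0 x] D[of 1 x] D[of 2 x] by (simp_all add: numeral_2_eq_2)
  have "bounded (closure (support_on UNIV \<psi>))"
    using \<psi> by (auto simp: test_functions_def intro: compact_imp_bounded)
  then obtain R where R: "\<And>x. x \<in> closure (support_on UNIV \<psi>) \<Longrightarrow> norm x < R"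
    by (auto simp: bounded_pos_less)
  have zero: "\<psi> x = 0" if "x \<in> - cball 0 R" for x
    using R[of x] that closure_subset[of "support_on UNIV \<psi>"] by (force simp: in_support_on)
  \<comment> \<open>Openness of the complement makes the derivatives of \<open>\<psi>\<close> vanish
    there too.\<close>
  have "open (- cball 0 R :: real set)" by auto
  have zero1: "deriv \<psi> x = 0" if "x \<in> - cball 0 R" for x
    by (rule DERIV_unique[OF D0 has_field_derivative_transform_within_open[OF DERIV_const _ that]])
      (use zero in \<open>auto simp: \<open>open (- cball 0 R :: real set)\<close>\<close>)
  have zero2: "deriv (deriv \<psi>) x = 0" if "x \<in> - cball 0 R" for x
    by (rule DERIV_unique[OF D1 has_field_derivative_transform_within_open[OF DERIV_const _ that]])
      (use zero1 in \<open>auto simp: \<open>open (- cball 0 R :: real set)\<close>\<close>)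
  \<comment> \<open>The \<open>+ 1\<close> puts both endpoints strictly outside
    \<open>cball 0 R\<close>, and the absolute value ensures \<open>-r \<le> r\<close>.\<close>
  define r where "r = \<bar>R\<bar> + 1"
  have out: "x \<in> - cball 0 R" if "x \<notin> {-r<..<r}" for x
    using that by (auto simp: r_def)
  define F where "F x = (a * x\<^sup>2 + b * x + c) * deriv \<psi> x - (2 * a * x + b) * \<psi> x" for x
  define h where "h x = (a * x\<^sup>2 + b * x + c) * deriv (deriv \<psi>) x" for x
  have "has_bochner_integral lborel (\<lambda>x. (h x - 2 * a * \<psi> x) * indicator {-r..r} x) (F r - F (-r))"
  proof (rule has_bochner_integral_FTC_Icc_real)
    show "(F has_real_derivative h x - 2 * a * \<psi> x) (at x)" for x
      unfolding F_def h_def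
      by (auto intro!: derivative_eq_intros D0 D1 simp: algebra_simps)
    show "isCont (\<lambda>x. h x - 2 * a * \<psi> x) x" for x
      unfolding h_def using DERIV_isCont[OF D0] DERIV_isCont[OF D2] by (intro continuous_intros) auto
  qed (simp add: r_def)
  moreover have "F r - F (-r) = 0"
    using zero zero1 out[of r] out[of "-r"] by (simp add: F_def)
  moreover have "(h x - 2 * a * \<psi> x) * indicator {-r..r} x = h x - 2 * a * \<psi> x" for x
    using zero[of x] zero2[of x] out[of x] by (cases "x \<in> {-r..r}") (auto simp: h_def)
  ultimately have diff0: "has_bochner_integral lborel (\<lambda>x. h x - 2 * a * \<psi> x) 0" by simp
  \<comment> \<open>Integrability of \<open>\<psi>\<close> allows its integral to be added back to
    \<open>diff0\<close>, leaving that of \<open>h\<close>.\<close>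
  have "integrable lborel (\<lambda>x. \<psi> x * indicator {-r..r} x)"
    using borel_integrable_compact[of "{-r..r}" \<psi>] DERIV_isCont[OF D0]
    by (auto simp: mult.commute continuous_at_imp_continuous_on)
  moreover have "\<psi> x * indicator {-r..r} x = \<psi> x" for x
    using zero[of x] out[of x] by (cases "x \<in> {-r..r}") auto
  ultimately have "integrable lborel \<psi>" by simp
  then have "has_bochner_integral lborel (\<lambda>x. 2 * a * \<psi> x) (2 * a * (\<integral>x. \<psi> x \<partial>lborel))"
    by (intro has_bochner_integral_mult_right has_bochner_integral_integrable)
  from has_bochner_integral_add[OF diff0 this] show ?thesis
    by (simp add: h_def has_bochner_integral_integral_eq)
qed

lemma constant_functional_weak_bm_generator_quadratic:
  "constant_functional (weak_bm_generator (\<lambda>x. a * x\<^sup>2 + b * x + c))"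
  unfolding constant_functional_def
\<comment> \<open>The constant, still schematic here, becomes \<open>a\<close>: the factor 1/2 of
  the generator cancels the 2 in the second derivative \<open>2 * a\<close>.\<close>
proof (intro exI ballI)
  fix \<psi> assume \<psi>: "\<psi> \<in> test_functions"
  have "weak_bm_generator (\<lambda>x. a * x\<^sup>2 + b * x + c) \<psi> =
      (\<integral>x. (a * x\<^sup>2 + b * x + c) * deriv (deriv \<psi>) x / 2 \<partial>lborel)"
    by (simp add: weak_bm_generator_def weakly_extended_def pairing_def bm_generator_def)
  also have "\<dots> = pairing (\<lambda>_. a) \<psi>"
    using integral_mult_deriv_deriv_test_function[OF \<psi>, of a b c] by (simp add: pairing_def)
  finally show "weak_bm_generator (\<lambda>x. a * x\<^sup>2 + b * x + c) \<psi> = pairing (\<lambda>_. a) \<psi>" .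
qed

lemma twice_differentiable_quadratic:
  "twice_differentiable (\<lambda>x. a * x\<^sup>2 + b * x + c)"
proof -
  have D: "((\<lambda>x. a * x\<^sup>2 + b * x + c) has_real_derivative 2 * a * x + b) (at x)" for x
    by (auto intro!: derivative_eq_intros)
  then have "deriv (\<lambda>x. a * x\<^sup>2 + b * x + c) = (\<lambda>x. 2 * a * x + b)"
    by (auto intro!: DERIV_imp_deriv)
  moreover have "((\<lambda>x. 2 * a * x + b) has_real_derivative 2 * a) (at x)" for x
    by (auto intro!: derivative_eq_intros)
  ultimately show ?thesis
    using D unfolding twice_differentiable_def
    by (metis real_differentiable_def)
qed

section \<open>From the martingale property to the heat semigroup\<close>

text \<open>
  It suffices to test the martingale property on the events that \<open>B 1\<close> lies in a Borel set, so
  only the independence of the increments over \<open>[0, 1]\<close> and \<open>[1, 1 + \<sigma>\<^sup>2]\<close> is used. Starting at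
  time 1 rather than 0 gives \<open>B 1\<close> a positive density, hence an identity at almost every point.
\<close>

lemma heat_AE_eq_add_const_of_martingale:
  assumes bm: "brownian_motion M B"
    and [measurable]: "f \<in> borel_measurable borel"
    and f: "\<And>x. \<bar>f x\<bar> \<le> C * (1 + \<bar>x\<bar>) ^ N"
    and mart: "martingale M (natural_filtration M B) (\<lambda>t \<omega>. f (B t \<omega>) - (\<integral>\<omega>'. f (B t \<omega>') \<partial>M))"
    and \<sigma>: "\<sigma> > 0"
  shows "\<exists>c. AE x in lborel. heat \<sigma> f x = f x + c"
proof -
  interpret prob_space M using bm by (simp add: brownian_motion_def)
  define t where "t = 1 + \<sigma>\<^sup>2"
  have t: "1 < t" "0 \<le> t" using \<sigma> by (simp_all add: t_def add_nonneg_nonneg)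
  define m where "m s = (\<integral>\<omega>. f (B s \<omega>) \<partial>M)" for s
  define c where "c = m t - m 1"
  \<comment> \<open>As \<open>B 0 = 0\<close> holds only almost surely, the increment
    \<open>X\<close> stands in for \<open>B 1\<close>: the laws and the independence are given for
    increments.\<close>
  define X where "X \<omega> = B 1 \<omega> - B 0 \<omega>" for \<omega>
  define Y where "Y \<omega> = B t \<omega> - B 1 \<omega>" for \<omega>
  let ?F = "natural_filtration M B 1"
  have B_meas: "B s \<in> borel_measurable M" if "0 \<le> s" for s
    using bm that by (simp add: brownian_motion_def)
  have [measurable]: "B 0 \<in> borel_measurable M" "B 1 \<in> borel_measurable M" "B t \<in> borel_measurable M"
    using B_meas t by auto
  have [measurable]: "X \<in> borel_measurable M" "Y \<in> borel_measurable M"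
    unfolding X_def Y_def by measurable
  have B0: "AE \<omega> in M. B 0 \<omega> = 0" using bm by (simp add: brownian_motion_def)
  have incr: "distributed M lborel (\<lambda>\<omega>. B v \<omega> - B u \<omega>) (normal_density 0 (sqrt (v - u)))"
    if "0 \<le> u" "u < v" for u v
    using bm that by (simp add: brownian_motion_def)
  have dX: "distributed M lborel X \<phi>"
    unfolding X_def using incr[of 0 1] by simp
  have dY: "distributed M lborel Y (normal_density 0 \<sigma>)"
    unfolding Y_def using incr[of 1 t] \<sigma> by (simp add: t_def)
  have "indep_var borel X borel Y"
  proof -
    define \<tau> where "\<tau> = (\<lambda>i::nat. if i = 0 then 0 else if i = 1 then 1 else t)"
    have "indep_vars (\<lambda>_. borel) (\<lambda>i \<omega>. B (\<tau> (Suc i)) \<omega> - B (\<tau> i) \<omega>) {..<2::nat}"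
    proof -
      have "0 \<le> \<tau> 0 \<and> (\<forall>i<2. \<tau> i \<le> \<tau> (Suc i))"
        using t by (auto simp: \<tau>_def)
      then show ?thesis using bm unfolding brownian_motion_def by blast
    qed
    \<comment> \<open>The sum over the singleton \<open>{1}\<close> is the second increment, so
      \<open>indep_vars_sum\<close> yields independence of the pair.\<close>
    moreover have "{..<2::nat} = insert 0 {1}" by auto
    ultimately show ?thesis
      using indep_vars_sum[of "{1::nat}" 0 "\<lambda>i \<omega>. B (\<tau> (Suc i)) \<omega> - B (\<tau> i) \<omega>"]
      by (simp add: \<tau>_def X_def[abs_def] Y_def[abs_def])
  qed
  then have indep: "indep_var lborel X lborel Y"
    by (simp add: indep_var_eq measurable_lborel2)
  have dXY: "distributed M (lborel \<Otimes>\<^sub>M lborel) (\<lambda>\<omega>. (X \<omega>, Y \<omega>))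
      (\<lambda>p. \<phi> (fst p) * normal_density 0 \<sigma> (snd p))"
    using distributed_joint_indep[OF sigma_finite_lborel sigma_finite_lborel dX dY indep]
    by (simp add: case_prod_beta' ennreal_mult)
  have sub: "finite_measure_subalgebra M ?F"
    by (intro finite_measure_subalgebra.intro finite_measure_axioms
        finite_measure_subalgebra_axioms.intro subalgebra_natural_filtration B_meas)
  then interpret F: finite_measure_subalgebra M ?F .
  have int_mart: "integrable M (\<lambda>\<omega>. f (B s \<omega>) - m s)" if "0 \<le> s" for s
    using mart that unfolding martingale_def m_def by blast
  have int_f: "integrable M (\<lambda>\<omega>. f (B s \<omega>))" if "0 \<le> s" for s
    using Bochner_Integration.integrable_add[OF int_mart[OF that], of "\<lambda>_. m s"] by simp
  have ce: "AE \<omega> in M. real_cond_exp M ?F (\<lambda>\<omega>. f (B t \<omega>) - m t) \<omega> = f (B 1 \<omega>) - m 1"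
    using mart t unfolding martingale_def m_def by (auto dest!: spec[of _ 1])
  have int_heat: "integrable lborel (\<lambda>x. \<phi> x * heat \<sigma> f x)"
  proof -
    obtain C' where "\<And>x. \<bar>heat \<sigma> f x\<bar> \<le> C' * (1 + \<bar>x\<bar>) ^ N"
      using heat_bound[OF assms(2) f] by blast
    then show ?thesis by (intro integrable_normal_density_mult) auto
  qed
  have int_fc: "integrable lborel (\<lambda>x. \<phi> x * (f x + c))"
    unfolding distrib_left using integrable_normal_density_mult[OF _ f]
    by (intro Bochner_Integration.integrable_add) auto
  \<comment> \<open>Keeping the density \<open>\<phi>\<close> of \<open>X\<close> on both sides
    reduces the claim to integrals over Borel sets \<open>S\<close>, and each of these is the
    martingale identity on the event that \<open>B 1\<close> lies in \<open>S\<close>.\<close>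
  have "AE x in lborel. \<phi> x * heat \<sigma> f x = \<phi> x * (f x + c)"
  proof (rule density_unique_real[OF int_heat int_fc])
    fix S :: "real set" assume "S \<in> sets lborel"
    then have [measurable]: "S \<in> sets borel" by simp
    define A where "A = B 1 -` S \<inter> space M"
    have A: "A \<in> sets ?F"
      unfolding A_def sets_natural_filtration
      by (intro sigma_sets.Basic CollectI exI[of _ 1] exI[of _ S]) auto
    have AM: "A \<in> sets M"
      unfolding A_def by measurable
    define q where "q \<omega> = (indicator S (B 1 \<omega>) :: real)" for \<omega>
    have ind_A: "indicator A \<omega> = (indicator S (B 1 \<omega>) :: real)" if "\<omega> \<in> space M" for \<omega>
      using that by (simp add: A_def indicator_def)
    have BX: "AE \<omega> in M. B 1 \<omega> = X \<omega>" "AE \<omega> in M. B t \<omega> = X \<omega> + Y \<omega>"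
      using B0 by (auto simp: X_def Y_def)
    have "(\<integral>\<omega>\<in>A. (f (B t \<omega>) - m t) \<partial>M) = (\<integral>\<omega>\<in>A. real_cond_exp M ?F (\<lambda>\<omega>. f (B t \<omega>) - m t) \<omega> \<partial>M)"
      by (rule F.real_cond_exp_intA[OF int_mart[OF t(2)] A])
    also have "\<dots> = (\<integral>\<omega>\<in>A. (f (B 1 \<omega>) - m 1) \<partial>M)"
      unfolding set_lebesgue_integral_def using ce AM by (intro integral_cong_AE) auto
    finally have E0: "(\<integral>\<omega>. q \<omega> * (f (B t \<omega>) - m t) \<partial>M) = (\<integral>\<omega>. q \<omega> * (f (B 1 \<omega>) - m 1) \<partial>M)"
      unfolding set_lebesgue_integral_def by (simp add: ind_A q_def cong: Bochner_Integration.integral_cong)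
    have int_q: "integrable M (\<lambda>\<omega>. q \<omega> * h \<omega>)" if "integrable M h" for h :: "'a \<Rightarrow> real"
      using integrable_mult_indicator[OF AM that]
      by (simp add: ind_A q_def cong: Bochner_Integration.integrable_cong)
    \<comment> \<open>Moving the mean \<open>m t\<close> to the other side produces
      \<open>c = m t - m 1\<close>.\<close>
    have "(\<integral>\<omega>. q \<omega> * f (B t \<omega>) \<partial>M) = (\<integral>\<omega>. q \<omega> * (f (B t \<omega>) - m t) + q \<omega> * m t \<partial>M)"
      by (simp add: algebra_simps)
    also have "\<dots> = (\<integral>\<omega>. q \<omega> * (f (B 1 \<omega>) - m 1) \<partial>M) + (\<integral>\<omega>. q \<omega> * m t \<partial>M)"
      using E0 int_q int_q[of "\<lambda>_. 1"] int_mart t by (subst Bochner_Integration.integral_add) auto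
    also have "\<dots> = (\<integral>\<omega>. q \<omega> * (f (B 1 \<omega>) - m 1) + q \<omega> * m t \<partial>M)"
      using int_q int_q[of "\<lambda>_. 1"] int_mart by (subst Bochner_Integration.integral_add) auto
    also have "\<dots> = (\<integral>\<omega>. q \<omega> * (f (B 1 \<omega>) + c) \<partial>M)"
      by (simp add: c_def algebra_simps)
    finally have E: "(\<integral>\<omega>. indicator S (B 1 \<omega>) * f (B t \<omega>) \<partial>M) = (\<integral>\<omega>. indicator S (B 1 \<omega>) * (f (B 1 \<omega>) + c) \<partial>M)"
      unfolding q_def .
    \<comment> \<open>The chain runs through Fubini, the joint law of \<open>X\<close> and
      \<open>Y\<close>, the identity \<open>E\<close>, and back to the line through the law of
      \<open>X\<close>.\<close>
    have "(\<integral>x\<in>S. \<phi> x * heat \<sigma> f x \<partial>lborel) =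
      (\<integral>x. \<integral>y. \<phi> x * normal_density 0 \<sigma> y * (indicator S x * f (x + y)) \<partial>lborel \<partial>lborel)"
      unfolding set_lebesgue_integral_def heat_eq_integral_normal_density[OF \<sigma>]
      by (simp flip: integral_mult_right_zero add: mult_ac)
    also have "\<dots> = (\<integral>p. \<phi> (fst p) * normal_density 0 \<sigma> (snd p) * (indicator S (fst p) * f (fst p + snd p))
        \<partial>(lborel \<Otimes>\<^sub>M lborel))"
    proof -
      \<comment> \<open>Fubini needs integrability on the plane; it is transferred from that of
        \<open>f (B t \<omega>)\<close>, part of the martingale hypothesis.\<close>
      have "integrable M (\<lambda>\<omega>. indicator S (X \<omega>) * f (X \<omega> + Y \<omega>))"
        using int_q[OF int_f[OF t(2)]] BX
        by (subst (asm) integrable_cong_AE[where g = "\<lambda>\<omega>. indicator S (X \<omega>) * f (X \<omega> + Y \<omega>)"])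
          (auto simp: q_def)
      then have "integrable (lborel \<Otimes>\<^sub>M lborel) (\<lambda>p. \<phi> (fst p) * normal_density 0 \<sigma> (snd p) *
          (indicator S (fst p) * f (fst p + snd p)))"
        by (subst distributed_integrable[OF dXY]) auto
      from lborel_pair.integral_fst'[OF this] show ?thesis by simp
    qed
    also have "\<dots> = (\<integral>\<omega>. indicator S (X \<omega>) * f (X \<omega> + Y \<omega>) \<partial>M)"
      by (subst distributed_integral[OF dXY]) auto
    also have "\<dots> = (\<integral>\<omega>. indicator S (B 1 \<omega>) * f (B t \<omega>) \<partial>M)"
      using BX by (intro integral_cong_AE) auto
    also note E
    also have "(\<integral>\<omega>. indicator S (B 1 \<omega>) * (f (B 1 \<omega>) + c) \<partial>M) = (\<integral>\<omega>. indicator S (X \<omega>) * (f (X \<omega>) + c) \<partial>M)"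
      using BX by (intro integral_cong_AE) auto
    also have "\<dots> = (\<integral>x. \<phi> x * (indicator S x * (f x + c)) \<partial>lborel)"
      by (subst distributed_integral[OF dX]) auto
    also have "\<dots> = (\<integral>x\<in>S. \<phi> x * (f x + c) \<partial>lborel)"
      by (simp add: set_lebesgue_integral_def mult_ac)
    finally show "(\<integral>x\<in>S. \<phi> x * heat \<sigma> f x \<partial>lborel) = (\<integral>x\<in>S. \<phi> x * (f x + c) \<partial>lborel)" .
  qed
  then have "AE x in lborel. heat \<sigma> f x = f x + c"
    \<comment> \<open>The density is positive everywhere, so it cancels.\<close>
    using normal_density_pos[of 1 0] by (auto simp: less_le)
  then show ?thesis by blast
qed

theorem theorem3p1:
  fixes M :: "'a measure" and B :: "real \<Rightarrow> 'a \<Rightarrow> real" and f :: "real \<Rightarrow> real"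
  assumes "brownian_motion M B"
    and "f \<in> borel_measurable borel"
    and "polynomially_bounded f"
    and "martingale M (natural_filtration M B) (\<lambda>t \<omega>. f (B t \<omega>) - (\<integral>\<omega>'. f (B t \<omega>') \<partial>M))"
  shows "(\<exists>g :: real \<Rightarrow> real. twice_differentiable g \<and> (AE x in lborel. f x = g x) \<and>
            constant_functional (weak_bm_generator g)) \<and>
         (\<exists>a b c :: real. AE x in lborel. f x = a * x\<^sup>2 + b * x + c)"
proof -
  obtain C N where f: "\<And>x. \<bar>f x\<bar> \<le> C * (1 + \<bar>x\<bar>) ^ N"
    using assms(3) by (auto simp: polynomially_bounded_def)
  have "\<exists>c. AE x in lborel. heat \<sigma> f x = f x + c" if "\<sigma> > 0" for \<sigma>
    by (rule heat_AE_eq_add_const_of_martingale[OF assms(1,2) f assms(4) that])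
  \<comment> \<open>The constant depends on \<open>\<sigma>\<close>; choice turns it into a
    function.\<close>
  then obtain c where "\<And>\<sigma>. \<sigma> > 0 \<Longrightarrow> AE x in lborel. heat \<sigma> f x = f x + c \<sigma>"
    by metis
  then obtain a b d where "AE x in lborel. f x = a * x\<^sup>2 + b * x + d"
    using quadratic_AE_of_heat_AE_eq_add_const[OF assms(2) f] by blast
  \<comment> \<open>The same quadratic serves as \<open>g\<close> in the first claim and gives the
    coefficients in the second.\<close>
  then show ?thesis
    using twice_differentiable_quadratic[of a b d] constant_functional_weak_bm_generator_quadratic[of a b d]
    by blast
qed

end
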